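(* Let $V$ be an infinite dimensional separable metrizable topological vector space over $\mathbb{K}$ and let $W$ be a vector subspace of $V$. If $W$ is dense in $V$ and $V\setminus W$ is $(m,\dim V)$-lineable for some $m\in\mathbb{N}$, then $V\setminus W$ is pointwise maximal dense-lineable in $V$.
   Context: $\mathbb{K}$ denotes $\mathbb{R}$ or $\mathbb{C}$; $\mathbb{N}$ is the set of positive integers; dimension means algebraic (Hamel) dimension. A subset $A$ of a vector space $V$ is $\alpha$-lineable if $A\cup\{0\}$ contains an $\alpha$-dimensional vector subspace of $V$. For cardinals $\alpha\le\beta$, a non-void subset $A\subset V$ is $(\alpha,\beta)$-lineable if it is $\alpha$-lineable and for each $\alpha$-dimensional subspace $W_\alpha\subset A\cup\{0\}$ there is a $\beta$-dimensional subspace $W_\beta$ with $W_\alpha\subset W_\beta\subset A\cup\{0\}$. If $V$ is endowed with a topology, a non-void subset $A\subset V$ is pointwise maximal dense-lineable if for each $x\in A$ there is a dense subspace $W_x$ of $V$ with $\dim W_x=\dim V$ and $x\in W_x\subset A\cup\{0\}$. *)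

theory Defs
  imports "HOL-Analysis.Analysis"
begin

unbundle cardinal_syntax

text \<open>
  Cardinal numbers are represented, as in the library, by cardinal well-orders
  compared with \<open>=o\<close> and \<open>\<le>o\<close>; the natural number \<open>m\<close> is the cardinal \<open>|{..<m}|\<close>.
  The library's \<open>dim\<close> takes values in \<open>nat\<close> (and is 0 on infinite-dimensional spaces),
  so the algebraic dimension is defined here as a cardinal.
\<close>

text \<open>
  The scalar field ranges over the class \<open>real_normed_field\<close>. Both \<open>real\<close> and \<open>complex\<close> are
  instances, and by the Gelfand--Mazur theorem every instance is isometrically isomorphic to
  one of them. The ambient space is the whole type, with the topology of its type class;
  joint continuity of scalar multiplication refers to the product topology. No separation
  axiom is imposed here.
\<close>

locale topological_vector_space = vector_space scale
  for scale :: "'k::real_normed_field \<Rightarrow> 'v::topological_ab_group_add \<Rightarrow> 'v" +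
  assumes continuous_scale: "continuous_on UNIV (\<lambda>(c, x). scale c x)"
begin

definition hamel_dim :: "'v set \<Rightarrow> 'v rel" where
  "hamel_dim S = |SOME B. independent B \<and> span B = S|"

lemma hamel_dim_eq_card_of_basis:
  assumes "independent B" and "span B = S"
  shows "hamel_dim S =o |B|"
proof -
  let ?C = "SOME C. independent C \<and> span C = S"
  have "independent ?C \<and> span ?C = S"
    using someI[of "\<lambda>C. independent C \<and> span C = S" B] assms by blast
  then obtain f where "bij_betw f ?C B"
    using bij_if_span_eq_span_bases[of ?C B] assms by blast
  then show ?thesis
    unfolding hamel_dim_def using card_of_ordIso by blast
qed

definition lineable :: "'c rel \<Rightarrow> 'v set \<Rightarrow> bool" where
  "lineable \<alpha> A \<longleftrightarrow> (\<exists>S. subspace S \<and> hamel_dim S =o \<alpha> \<and> S \<subseteq> A \<union> {0})"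

definition pair_lineable :: "'c rel \<Rightarrow> 'd rel \<Rightarrow> 'v set \<Rightarrow> bool" where
  "pair_lineable \<alpha> \<beta> A \<longleftrightarrow>
     \<alpha> \<le>o \<beta> \<and> A \<noteq> {} \<and> lineable \<alpha> A \<and>
     (\<forall>S. subspace S \<and> hamel_dim S =o \<alpha> \<and> S \<subseteq> A \<union> {0} \<longrightarrow>
        (\<exists>T. subspace T \<and> hamel_dim T =o \<beta> \<and> S \<subseteq> T \<and> T \<subseteq> A \<union> {0}))"

definition pointwise_maximal_dense_lineable :: "'v set \<Rightarrow> bool" where
  "pointwise_maximal_dense_lineable A \<longleftrightarrow>
     A \<noteq> {} \<and>
     (\<forall>x\<in>A. \<exists>S. subspace S \<and> closure S = UNIV \<and> hamel_dim S =o hamel_dim UNIV \<and>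
        x \<in> S \<and> S \<subseteq> A \<union> {0})"

end

end

theory Submission
  imports Defs
begin

text \<open>
  A subspace \<open>D\<close> lies in \<open>(V - W) \<union> {0}\<close> exactly when it meets \<open>W\<close> only in \<open>0\<close>. Lineability of
  the complement gives such a subspace \<open>T\<close> of dimension \<open>dim V\<close>, so \<open>W\<close> has codimension
  \<open>dim V\<close>: projecting along \<open>W\<close> onto a complement is injective on \<open>T\<close>. Hence every
  complement of \<open>W\<close> has dimension \<open>dim V\<close>, in particular one with a basis \<open>B\<close> containing the
  prescribed point \<open>x\<close> (\<open>complement_basis_projection\<close>).

  That complement need not be dense, but adding vectors of \<open>W\<close> to the elements of \<open>B\<close> does not
  change their classes modulo \<open>W\<close>; such a shift therefore preserves both the trivial
  intersection with \<open>W\<close> and the dimension. Because \<open>V\<close> is second countable, density requires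
  meeting only countably many open sets \<open>U n\<close>. Each contains some \<open>w n\<close> of the dense \<open>W\<close>, and by
  continuity also \<open>w n + c n \<cdot> b n\<close> for a small \<open>c n \<noteq> 0\<close>, where the \<open>b n\<close> are distinct elements
  of \<open>B - {x}\<close>. Shifting \<open>b n\<close> by \<open>inverse (c n) \<cdot> w n\<close> and fixing the rest of \<open>B\<close>, including \<open>x\<close>,
  yields a dense subspace (\<open>dense_transversal_subspace\<close>).
\<close>

section \<open>Countable families of open sets that detect density\<close>

lemma second_countable_if_metrizable_separable:
  assumes "metrizable_space X" and "separable_space X"
  shows "second_countable X"
proof -
  obtain M d where "Metric_space M d" and X: "X = Metric_space.mtopology M d"
    using assms(1) unfolding metrizable_space_def by blast
  then interpret Metric_space M d by simp
  obtain C where C: "countable C" "C \<subseteq> M" "X closure_of C = M"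
    using assms(2) unfolding separable_space_def X by auto
  let ?\<B> = "(\<lambda>(c, n). mball c (inverse (real (Suc n)))) ` (C \<times> (UNIV :: nat set))"
  have "\<exists>V\<in>?\<B>. x \<in> V \<and> V \<subseteq> U" if "openin X U" "x \<in> U" for U x
  proof -
    have "x \<in> M" using that openin_subset X by fastforce
    obtain r where r: "r > 0" "mball x r \<subseteq> U"
      using \<open>openin X U\<close> \<open>x \<in> U\<close> unfolding X openin_mtopology by blast
    obtain n where n: "inverse (real (Suc n)) < r / 2"
      using reals_Archimedean[of "r / 2"] half_gt_zero[OF r(1)] by blast
    have "x \<in> {x \<in> M. \<forall>r>0. \<exists>c\<in>C. c \<in> mball x r}"
      using C(3) \<open>x \<in> M\<close> unfolding X metric_closure_of by blast
    moreover have "inverse (real (Suc n)) > 0" by simp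
    ultimately obtain c where "c \<in> C" "c \<in> mball x (inverse (real (Suc n)))" by blast
    then have c: "c \<in> C" "d x c < inverse (real (Suc n))" by (simp_all only: in_mball)
    have "mball c (inverse (real (Suc n))) \<subseteq> mball x r"
    proof
      fix y assume "y \<in> mball c (inverse (real (Suc n)))"
      then have "y \<in> M" "d c y < inverse (real (Suc n))" "c \<in> M" by auto
      moreover from this have "d x y \<le> d x c + d c y" using triangle \<open>x \<in> M\<close> by blast
      ultimately show "y \<in> mball x r" using c n \<open>x \<in> M\<close> by simp
    qed
    moreover have "x \<in> mball c (inverse (real (Suc n)))"
      using c C(2) \<open>x \<in> M\<close> commute by auto
    ultimately show ?thesis using c(1) r(2) by blast
  qed
  moreover have "countable ?\<B>" "\<forall>V\<in>?\<B>. openin X V"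
    using C(1) unfolding X by auto
  ultimately show ?thesis unfolding second_countable_def by blast
qed

text \<open>
  Density of a set need only be tested on the members of this sequence. They are indexed by
  the naturals, with repetitions if need be, so that each can be assigned its own basis vector.
\<close>

lemma countable_pi_base:
  assumes "second_countable X" and "topspace X \<noteq> {}"
  obtains U :: "nat \<Rightarrow> 'a set"
  where "\<And>n. openin X (U n)" "\<And>n. U n \<noteq> {}"
    "\<And>S. openin X S \<Longrightarrow> S \<noteq> {} \<Longrightarrow> \<exists>n. U n \<subseteq> S"
proof -
  obtain \<B> where \<B>: "countable \<B>" "\<forall>V\<in>\<B>. openin X V"
    "\<And>S x. openin X S \<Longrightarrow> x \<in> S \<Longrightarrow> \<exists>V\<in>\<B>. x \<in> V \<and> V \<subseteq> S"
    using assms(1) unfolding second_countable_def by metis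
  have "\<B> - {{}} \<noteq> {}"
    using \<B>(3)[OF openin_topspace] assms(2) by blast
  then have range: "range (from_nat_into (\<B> - {{}})) = \<B> - {{}}"
    using \<B>(1) by (intro range_from_nat_into) auto
  show thesis
  proof
    fix n
    have "from_nat_into (\<B> - {{}}) n \<in> \<B> - {{}}" using range by blast
    then show "openin X (from_nat_into (\<B> - {{}}) n)" "from_nat_into (\<B> - {{}}) n \<noteq> {}"
      using \<B>(2) by auto
  next
    fix S assume "openin X S" "S \<noteq> {}"
    then obtain V where "V \<in> \<B> - {{}}" "V \<subseteq> S" using \<B>(3) by blast
    then show "\<exists>n. from_nat_into (\<B> - {{}}) n \<subseteq> S" using range by (metis rangeE)
  qed
qed

section \<open>Complements of a subspace and their dimension\<close>

context vector_space
begin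

text \<open>
  Extend \<open>A\<close> to a basis of \<open>span B\<close>: any two bases of a space are equipotent, also when they
  are infinite.
\<close>

lemma card_of_independent_le_basis:
  assumes "independent A" and "A \<subseteq> span B" and "independent B"
  shows "|A| \<le>o |B|"
proof -
  obtain C where C: "A \<subseteq> C" "C \<subseteq> span B" "independent C" "span B \<subseteq> span C"
    using maximal_independent_subset_extend[OF assms(2,1)] by blast
  then have "span C = span B" using span_minimal[OF C(2)] by auto
  then obtain f where "bij_betw f C B"
    using bij_if_span_eq_span_bases[OF C(3) assms(3)] by blast
  then have "|C| =o |B|" using card_of_ordIso by blast
  then show ?thesis using card_of_mono1[OF C(1)] ordLeq_ordIso_trans by blast
qed

text \<open>
  Since \<open>x \<notin> W\<close>, a basis of \<open>W\<close> together with \<open>x\<close> extends to a basis of the whole space; the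
  vectors outside the basis of \<open>W\<close> span a complement, and \<open>p\<close> is the projection onto it along
  \<open>W\<close>. The projection represents the quotient map modulo \<open>W\<close> inside the space itself.
\<close>

lemma complement_basis_projection:
  assumes "subspace W" and "x \<notin> W"
  obtains B p where "independent B" "x \<in> B" "Vector_Spaces.linear scale scale p"
    "\<And>v. p v \<in> span B" "\<And>b. b \<in> span B \<Longrightarrow> p b = b" "\<And>v. p v = 0 \<longleftrightarrow> v \<in> W"
proof -
  interpret vector_space_pair scale scale ..
  obtain C where C: "C \<subseteq> W" "independent C" "W \<subseteq> span C"
    by (rule basis_exists)
  have span_C: "span C = W" using span_subspace[OF C(1,3) assms(1)] .
  have "independent (insert x C)"
    using independent_insertI[of x C] C(2) span_C assms(2) by simp
  then obtain E where E: "insert x C \<subseteq> E" "independent E" "span E = UNIV"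
    using extend_basis_superset[of "insert x C"] independent_extend_basis[of "insert x C"]
      span_extend_basis[of "insert x C"] by blast
  obtain p where p: "Vector_Spaces.linear scale scale p"
    "\<And>e. e \<in> E \<Longrightarrow> p e = (if e \<in> C then 0 else e)"
    using linear_independent_extend[OF E(2), of "\<lambda>e. if e \<in> C then 0 else e"] by blast
  interpret p: Vector_Spaces.linear scale scale p by fact
  interpret q: Vector_Spaces.linear scale scale "\<lambda>v. v - p v"
    using p(1) by (intro linear_compose_sub) (auto simp: linear_ident)
  have range: "p v \<in> span (E - C)" for v
  proof -
    have "p v \<in> span (p ` E)" using E(3) p.span_image[of E] by blast
    also have "span (p ` E) \<subseteq> span (E - C)"
      by (rule span_minimal) (auto simp: p(2) span_zero intro: span_base)
    finally show ?thesis .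
  qed
  have id: "p b = b" if "b \<in> span (E - C)" for b
    using linear_eq_on[OF p(1) linear_ident that] p(2) by auto
  have "p e = 0" if "e \<in> C" for e
    using p(2)[of e] E(1) that by auto
  then have kernel: "p w = 0" if "w \<in> W" for w
    using linear_eq_on[OF p(1) linear_zero, of w C] that span_C by simp
  have complement: "v - p v \<in> W" for v
  proof -
    have "v - p v \<in> span ((\<lambda>v. v - p v) ` E)" using E(3) q.span_image[of E] by blast
    also have "\<dots> \<subseteq> span C"
      by (rule span_minimal) (auto simp: p(2) span_zero intro: span_base)
    finally show ?thesis using span_C by simp
  qed
  show thesis
  proof
    show "independent (E - C)" using E(2) independent_mono by blast
    show "x \<in> E - C" using E(1) C(1) assms(2) by blast
    show "p v = 0 \<longleftrightarrow> v \<in> W" for v using kernel complement[of v] by auto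
  qed (use p(1) range id in auto)
qed

end

section \<open>Dense subspaces transversal to a dense subspace\<close>

context topological_vector_space
begin

lemma hamel_dim_basis:
  assumes "subspace S"
  obtains B where "independent B" "span B = S" "|B| =o hamel_dim S"
proof -
  obtain B where B: "B \<subseteq> S" "independent B" "S \<subseteq> span B"
    by (rule basis_exists)
  have "span B = S" using span_subspace[OF B(1,3) assms] .
  then show thesis
    using that[OF B(2)] ordIso_symmetric[OF hamel_dim_eq_card_of_basis[OF B(2)]] by blast
qed

lemma small_multiple_stays_in_open:
  assumes "open U" and "w \<in> U"
  obtains c where "c \<noteq> 0" "w + scale c b \<in> U"
proof -
  have "continuous_on UNIV (\<lambda>c. w + scale c b)"
    by (intro continuous_intros
        continuous_on_compose2[OF continuous_scale, of _ "\<lambda>c. (c, b)", simplified])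
  then have "open ((\<lambda>c. w + scale c b) -` U)" by (rule open_vimage[OF assms(1)])
  moreover have "0 \<in> (\<lambda>c. w + scale c b) -` U" using assms(2) by simp
  ultimately obtain e where e: "e > 0" "ball 0 e \<subseteq> (\<lambda>c. w + scale c b) -` U"
    by (rule openE)
  have "of_real (e / 2) \<in> ball (0::'k) e" using e(1) by simp
  then have "w + scale (of_real (e / 2)) b \<in> U" using e(2) by blast
  moreover have "of_real (e / 2) \<noteq> (0::'k)" using e(1) by simp
  ultimately show thesis using that by blast
qed

text \<open>
  Being transversal to \<open>W\<close> depends only on classes modulo \<open>W\<close>, whereas being dense can be
  achieved by moving within those classes, because \<open>W\<close> is dense. Infinitely many basis vectors
  are needed, one for each set of a countable family of open sets.
\<close>

lemma dense_transversal_subspace: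
  assumes "second_countable (euclidean :: 'v topology)"
    and "subspace W" and "closure W = UNIV"
    and "independent B" and "infinite B" and "x \<in> B"
    and "span B \<inter> W \<subseteq> {0}"
  obtains D where "subspace D" "closure D = UNIV" "hamel_dim D =o |B|"
    "x \<in> D" "D \<inter> W \<subseteq> {0}"
proof -
  interpret vector_space_pair scale scale ..
  obtain U :: "nat \<Rightarrow> 'v set" where U: "\<And>n. open (U n)" "\<And>n. U n \<noteq> {}"
    "\<And>S. open S \<Longrightarrow> S \<noteq> {} \<Longrightarrow> \<exists>n. U n \<subseteq> S"
    by (rule countable_pi_base[OF assms(1), folded open_openin, simplified]) blast
  obtain b :: "nat \<Rightarrow> 'v" where b: "inj b" "range b \<subseteq> B - {x}"
    using infinite_countable_subset[of "B - {x}"] \<open>infinite B\<close>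
    by (meson finite_Diff2 finite.emptyI finite_insert)
  have "\<exists>w. w \<in> W \<and> w \<in> U n" for n
    using assms(3) U(1,2)[of n] open_Int_closure_eq_empty[of "U n" W] by auto
  then obtain w where w: "\<And>n. w n \<in> W" "\<And>n. w n \<in> U n" by metis
  have "\<exists>c. c \<noteq> 0 \<and> w n + scale c (b n) \<in> U n" for n
    using small_multiple_stays_in_open[OF U(1) w(2), of n "b n"] by blast
  then obtain c where c: "\<And>n. c n \<noteq> 0" "\<And>n. w n + scale (c n) (b n) \<in> U n" by metis
  \<comment> \<open>Dividing by \<open>c n\<close> keeps the coefficient of \<open>b n\<close> equal to 1, so that the shifted vector is
    congruent to \<open>b n\<close> modulo \<open>W\<close>; its span still contains \<open>w n + c n \<cdot> b n\<close>. The value at \<open>x\<close> is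
    0 because \<open>b\<close> avoids \<open>x\<close>, which keeps \<open>x\<close> in the span.\<close>
  define \<omega> where
    "\<omega> v = (if v \<in> range b then scale (inverse (c (inv b v))) (w (inv b v)) else 0)" for v
  have \<omega>_W: "\<omega> v \<in> W" for v
    using w(1) assms(2) by (auto simp: \<omega>_def subspace_scale subspace_0)
  obtain L where L: "Vector_Spaces.linear scale scale L" "\<And>v. v \<in> B \<Longrightarrow> L v = v + \<omega> v"
    using linear_independent_extend[OF assms(4), of "\<lambda>v. v + \<omega> v"] by blast
  interpret L: Vector_Spaces.linear scale scale L by fact
  interpret shift: Vector_Spaces.linear scale scale "\<lambda>v. L v - v"
    using L(1) by (intro linear_compose_sub) (auto simp: linear_ident)
  have shift_in_W: "L t - t \<in> W" if "t \<in> span B" for t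
  proof -
    have "L t - t \<in> span ((\<lambda>v. L v - v) ` B)" using that shift.span_image[of B] by blast
    also have "\<dots> \<subseteq> W"
      using L(2) \<omega>_W assms(2) by (intro span_minimal) auto
    finally show ?thesis .
  qed
  have transversal: "t = 0" if "t \<in> span B" "L t \<in> W" for t
  proof -
    have "L t - (L t - t) \<in> W"
      using subspace_diff[OF assms(2) that(2) shift_in_W[OF that(1)]] .
    then show ?thesis using that(1) assms(7) by auto
  qed
  have inj: "inj_on L (span B)"
    unfolding L.inj_on_iff_eq_0[OF subspace_span]
    using transversal subspace_0[OF assms(2)] by auto
  have D_eq: "span (L ` B) = L ` span B" by (rule L.span_image)
  show thesis
  proof
    show "subspace (span (L ` B))" by simp
    show "x \<in> span (L ` B)"
    proof -
      have "L x = x" using L(2) assms(6) b(2) by (auto simp: \<omega>_def)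
      then show ?thesis using assms(6) by (metis imageI span_base)
    qed
    show "span (L ` B) \<inter> W \<subseteq> {0}"
    proof
      fix v assume "v \<in> span (L ` B) \<inter> W"
      then obtain t where "t \<in> span B" "v = L t" "v \<in> W" using D_eq by blast
      then have "t = 0" using transversal by simp
      then show "v \<in> {0}" using \<open>v = L t\<close> L.zero by simp
    qed
    have "|L ` B| =o |B|"
      using inj_on_subset[OF inj span_superset] inj_on_imp_bij_betw card_of_ordIso ordIso_symmetric
      by blast
    then show "hamel_dim (span (L ` B)) =o |B|"
      using hamel_dim_eq_card_of_basis[OF L.independent_injective_image[OF assms(4) inj] refl]
        ordIso_transitive by blast
    have "w n + scale (c n) (b n) \<in> span (L ` B)" for n
    proof -
      have "b n \<in> B" using b(2) by blast
      moreover from this have "L (b n) = b n + scale (inverse (c n)) (w n)"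
        using L(2) b(1) by (simp add: \<omega>_def)
      then have "scale (c n) (L (b n)) = w n + scale (c n) (b n)"
        using c(1) by (simp add: scale_right_distrib)
      ultimately show ?thesis by (metis imageI span_base span_scale)
    qed
    then have "span (L ` B) \<inter> S \<noteq> {}" if "open S" "S \<noteq> {}" for S
      using U(3)[OF that] c(2) by blast
    then have "- closure (span (L ` B)) = {}"
      using closure_subset[of "span (L ` B)"] open_Compl[OF closed_closure] by blast
    then show "closure (span (L ` B)) = UNIV" by blast
  qed
qed

end

theorem theorem5p3:
  fixes scale :: "'k::real_normed_field \<Rightarrow> 'v::topological_ab_group_add \<Rightarrow> 'v"
    and W :: "'v set" and m :: nat
  assumes "topological_vector_space scale"
    and "metrizable_space (euclidean :: 'v topology)"
    and "separable_space (euclidean :: 'v topology)"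
    and "cinfinite (topological_vector_space.hamel_dim scale (UNIV :: 'v set))"
    and "module.subspace scale W"
    and "closure W = UNIV"
    and "m \<ge> 1"
    and "topological_vector_space.pair_lineable scale
           |{..<m}| (topological_vector_space.hamel_dim scale (UNIV :: 'v set)) (UNIV - W)"
  shows "topological_vector_space.pointwise_maximal_dense_lineable scale (UNIV - W)"
proof -
  interpret topological_vector_space scale by fact
  let ?\<kappa> = "hamel_dim UNIV"
  obtain T where T: "subspace T" "hamel_dim T =o ?\<kappa>" "T \<subseteq> UNIV - W \<union> {0}"
    using assms(8) unfolding pair_lineable_def lineable_def by (elim conjE exE) metis
  obtain A where A: "independent A" "span A = T" "|A| =o hamel_dim T"
    by (rule hamel_dim_basis[OF T(1)])
  have card_A: "|A| =o ?\<kappa>" by (rule ordIso_transitive[OF A(3) T(2)])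
  obtain E where E: "independent E" "span E = UNIV" "|E| =o ?\<kappa>"
    by (rule hamel_dim_basis[OF subspace_UNIV])
  have second_countable: "second_countable (euclidean :: 'v topology)"
    by (rule second_countable_if_metrizable_separable[OF assms(2,3)])
  have "\<exists>S. subspace S \<and> closure S = UNIV \<and> hamel_dim S =o ?\<kappa> \<and> x \<in> S \<and> S \<subseteq> UNIV - W \<union> {0}"
    if "x \<notin> W" for x
  proof -
    obtain B p where B: "independent B" "x \<in> B" and p: "Vector_Spaces.linear scale scale p"
      "\<And>v. p v \<in> span B" "\<And>b. b \<in> span B \<Longrightarrow> p b = b" "\<And>v. p v = 0 \<longleftrightarrow> v \<in> W"
      by (rule complement_basis_projection[OF assms(5) \<open>x \<notin> W\<close>]) blast
    interpret p: Vector_Spaces.linear scale scale p by fact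
    have inj: "inj_on p (span A)"
      using p.inj_on_iff_eq_0[OF subspace_span, of A] p(4) T(3) A(2) by auto
    \<comment> \<open>The basis \<open>A\<close> of \<open>T\<close> projects to an independent subset of \<open>span B\<close>, which forces \<open>B\<close> to
      be as large as a basis of the whole space.\<close>
    have "|A| =o |p ` A|"
      using inj_on_subset[OF inj span_superset] inj_on_imp_bij_betw card_of_ordIso by blast
    moreover have "|p ` A| \<le>o |B|"
      using card_of_independent_le_basis[OF p.independent_injective_image[OF A(1) inj] _ B(1)] p(2)
      by blast
    ultimately have "?\<kappa> \<le>o |B|"
      using ordIso_ordLeq_trans[OF ordIso_transitive[OF ordIso_symmetric[OF card_A]]] by blast
    moreover have "|B| \<le>o |E|"
      using card_of_independent_le_basis[OF B(1) _ E(1)] E(2) by simp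
    then have "|B| \<le>o ?\<kappa>" by (rule ordLeq_ordIso_trans[OF _ E(3)])
    ultimately have card_B: "|B| =o ?\<kappa>" by (simp add: ordIso_iff_ordLeq)
    have B_W: "span B \<inter> W \<subseteq> {0}" using p(3,4) by force
    have "infinite B"
      using cinfinite_mono[OF \<open>?\<kappa> \<le>o |B|\<close> assms(4)] by (simp add: cinfinite_def Field_card_of)
    then obtain D where D: "subspace D" "closure D = UNIV" "hamel_dim D =o |B|" "x \<in> D"
      "D \<inter> W \<subseteq> {0}"
      by (rule dense_transversal_subspace[OF second_countable assms(5,6) B(1) _ B(2) B_W])
    have "hamel_dim D =o ?\<kappa>" by (rule ordIso_transitive[OF D(3) card_B])
    then show ?thesis using D by (intro exI[of _ D]) auto
  qed
  moreover have "UNIV - W \<noteq> {}" using assms(8) unfolding pair_lineable_def by blast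
  ultimately show ?thesis unfolding pointwise_maximal_dense_lineable_def by blast
qed

end
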